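(* Suppose the transition kernels $P$ on the Polish space $\mathcal{X}$ satisfy the Drift Condition (with function $V$) and Doeblin's Condition, both stated in the context, and let $(\mu_n)_{n\in\mathbb{Z}}$ be the associated invariant measure family described in the context. Let $x\in\mathcal{X}$ be such that $V(x)<\infty$. Let $g:\mathcal{X}\to\mathbb{R}$ be a bounded measurable function, and write $\mu_k(g)=\int_{\mathcal{X}}g\,d\mu_k$. Then, for the time-inhomogeneous Markov chain $(X_n)_{n\in\mathbb{Z}_+}$ with transition probability $P$ and $X_0\sim\epsilon_x$ (Dirac mass at $x$), we have $$\frac1n\sum_{k=0}^{n-1}g(X_k)-\frac1n\sum_{k=0}^{n-1}\mu_k(g)\xrightarrow[n\to\infty]{\text{a.s.}}0 .$$
   Context: Setting. $\mathcal{X}$ is a Polish space with Borel $\sigma$-field $\mathcal{B}(\mathcal{X})$. $P$ is a family of transition probability kernels: for integers $m\le n$ and $x\in\mathcal{X}$, $P(m,x,n,\cdot)$ is a probability measure on $\mathcal{X}$ (measurable in $x$), $P(m,x,m,\cdot)=\epsilon_x$ (Dirac mass), and for all integers $m_1\le m_2\le m_3$, $x\in\mathcal{X}$, $A\in\mathcal{B}(\mathcal{X})$, the Chapman--Kolmogorov identity $P(m_1,x,m_3,A)=\int_{\mathcal{X}}P(m_1,x,m_2,dy)P(m_2,y,m_3,A)$ holds. Markov chain. A time-inhomogeneous Markov chain $(X_n)_{n\in\mathbb{Z}_+}$ with transition probability $P$ is a process with $\mathbb{P}(X_{n+1}\in A\mid X_j: j\le n)=P(n,X_n,n+1,A)$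 a.s. for all $n\in\mathbb{Z}_+$ and $A\in\mathcal{B}(\mathcal{X})$. Total variation norm. For a finite signed measure, $\|\mu\|_{\mathrm{TV}}=\sup_{\|\varphi\|_\infty\le1}\left|\int\varphi\,d\mu\right|$, the supremum being over measurable $\varphi:\mathcal{X}\to\mathbb{R}$. Drift Condition. There is a Borel measurable $V:\mathcal{X}\to[0,\infty]$ such that (i) $\{x:V(x)<\infty\}\neq\emptyset$; (ii) there exist $0<\gamma<1$ and $C>0$ such that for all $x\in\mathcal{X}$ and $n\in\mathbb{Z}$, $\int_{\mathcal{X}}V(y)P(n-1,x,n,dy)\le\gamma V(x)+C$. Doeblin's Condition. For $R>0$ let $\mathcal{C}(R)=\{x\in\mathcal{X}:V(x)\le R\}$. For every $R>0$ there exist $0<\beta<1$ and a probability measure $\nu$ on $\mathcal{X}$ such that for every $n\in\mathbb{Z}$ and $x\in\mathcal{C}(R)$, $P(n-1,x,n,\cdot)\ge\beta\nu(\cdot)$. Invariant measure family. Doeblin's Condition implies the Contraction Condition: for every $R>0$ there exist $n_0\in\mathbb{N}$, $0<\delta<1$ with $\|P(n-n_0,x,n,\cdot)-P(n-n_0,y,n,\cdot)\|_{\mathrm{TV}}\le2(1-\delta)$ for all $n\in\mathbb{Z}$ and all $x,y$ with $V(x)+V(y)\le R$. By a theorem of Liu and Lu, under the Drift and Contraction Conditions there exists a unique family $(\mu_n)_{n\in\mathbb{Z}}$ of probability measures on $\mathcal{X}$ such that (a) $\mu_n(A)=\int_{\mathcal{X}}P(m,x,n,A)\,\mu_m(dx)$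 for all integers $m\le n$ and $A\in\mathcal{B}(\mathcal{X})$; (b) $\int_{\mathcal{X}}V\,d\mu_n<\infty$ for every $n\in\mathbb{Z}$; (c) there exist constants $0<\alpha<1$ and $\tilde M>0$ with $\|P(n-m,x,n,\cdot)-\mu_n\|_{\mathrm{TV}}\le\tilde M\alpha^m(1+V(x))$ for all $n\in\mathbb{Z}$, $m\in\mathbb{N}$, $x\in\mathcal{X}$. This is the family meant in the claim. *)

theory Defs
  imports "HOL-Probability.Probability"
begin

(* Membership in the measurable functions into prob_algebra borel says that each P m x n is a
   Borel probability measure and that x |-> P m x n A is measurable for every Borel set A.
   Nothing is required of P m x n when n < m. *)
definition transition_kernels :: "(int \<Rightarrow> 'a::polish_space \<Rightarrow> int \<Rightarrow> 'a measure) \<Rightarrow> bool" where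
  "transition_kernels P \<longleftrightarrow>
     (\<forall>m n. m \<le> n \<longrightarrow> (\<lambda>x. P m x n) \<in> borel \<rightarrow>\<^sub>M prob_algebra borel) \<and>
     (\<forall>m x. P m x m = return borel x) \<and>
     (\<forall>m1 m2 m3 x. \<forall>A\<in>sets borel. m1 \<le> m2 \<longrightarrow> m2 \<le> m3 \<longrightarrow>
        emeasure (P m1 x m3) A = (\<integral>\<^sup>+ y. emeasure (P m2 y m3) A \<partial>P m1 x m2))"

definition past_algebra :: "'w measure \<Rightarrow> (nat \<Rightarrow> 'w \<Rightarrow> 'a::topological_space) \<Rightarrow> nat \<Rightarrow> 'w measure" where
  "past_algebra M X n = sigma (space M) {X j -` A \<inter> space M | j A. j \<le> n \<and> A \<in> sets borel}"

definition markov_chain ::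
  "(int \<Rightarrow> 'a::polish_space \<Rightarrow> int \<Rightarrow> 'a measure) \<Rightarrow> 'w measure \<Rightarrow> (nat \<Rightarrow> 'w \<Rightarrow> 'a) \<Rightarrow> bool" where
  "markov_chain P M X \<longleftrightarrow>
     prob_space M \<and> (\<forall>n. X n \<in> borel_measurable M) \<and>
     (\<forall>n. \<forall>A\<in>sets borel. AE \<omega> in M.
        real_cond_exp M (past_algebra M X n) (\<lambda>\<omega>'. indicat_real A (X (Suc n) \<omega>')) \<omega>
          = measure (P (int n) (X n \<omega>) (int (Suc n))) A)"

(* The total variation norm of the signed measure M - N, for finite Borel measures M and N.
   Taken in ennreal because it is compared with bounds that may be infinite. *)
definition tv_norm_diff :: "'a::topological_space measure \<Rightarrow> 'a measure \<Rightarrow> ennreal" where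
  "tv_norm_diff M N =
     (SUP \<phi>\<in>{\<phi>. \<phi> \<in> borel_measurable borel \<and> (\<forall>x. \<bar>\<phi> x\<bar> \<le> (1::real))}.
        ennreal \<bar>(\<integral>x. \<phi> x \<partial>M) - (\<integral>x. \<phi> x \<partial>N)\<bar>)"

definition drift_condition ::
  "(int \<Rightarrow> 'a::polish_space \<Rightarrow> int \<Rightarrow> 'a measure) \<Rightarrow> ('a \<Rightarrow> ennreal) \<Rightarrow> bool" where
  "drift_condition P V \<longleftrightarrow>
     V \<in> borel_measurable borel \<and>
     {x. V x < \<infinity>} \<noteq> {} \<and>
     (\<exists>\<gamma> C :: real. 0 < \<gamma> \<and> \<gamma> < 1 \<and> 0 < C \<and>
        (\<forall>x n. (\<integral>\<^sup>+ y. V y \<partial>P (n - 1) x n) \<le> ennreal \<gamma> * V x + ennreal C))"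

definition doeblin_condition ::
  "(int \<Rightarrow> 'a::polish_space \<Rightarrow> int \<Rightarrow> 'a measure) \<Rightarrow> ('a \<Rightarrow> ennreal) \<Rightarrow> bool" where
  "doeblin_condition P V \<longleftrightarrow>
     (\<forall>R::real. 0 < R \<longrightarrow>
        (\<exists>(\<beta>::real) \<nu>. 0 < \<beta> \<and> \<beta> < 1 \<and> \<nu> \<in> space (prob_algebra borel) \<and>
           (\<forall>n. \<forall>x\<in>{x. V x \<le> ennreal R}. \<forall>A\<in>sets borel.
              ennreal \<beta> * emeasure \<nu> A \<le> emeasure (P (n - 1) x n) A)))"

(* The three properties that, under the drift and Doeblin conditions, determine the family
   uniquely (Liu and Lu). *)
definition invariant_family ::
  "(int \<Rightarrow> 'a::polish_space \<Rightarrow> int \<Rightarrow> 'a measure) \<Rightarrow> ('a \<Rightarrow> ennreal) \<Rightarrow> (int \<Rightarrow> 'a measure) \<Rightarrow> bool" where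
  "invariant_family P V \<mu> \<longleftrightarrow>
     (\<forall>n. \<mu> n \<in> space (prob_algebra borel)) \<and>
     (\<forall>m n. \<forall>A\<in>sets borel. m \<le> n \<longrightarrow>
        emeasure (\<mu> n) A = (\<integral>\<^sup>+ x. emeasure (P m x n) A \<partial>\<mu> m)) \<and>
     (\<forall>n. (\<integral>\<^sup>+ x. V x \<partial>\<mu> n) < \<infinity>) \<and>
     (\<exists>\<alpha> C :: real. 0 < \<alpha> \<and> \<alpha> < 1 \<and> 0 < C \<and>
        (\<forall>n x. \<forall>m::nat.
           tv_norm_diff (P (n - int m) x n) (\<mu> n) \<le> ennreal (C * \<alpha> ^ m) * (1 + V x)))"

end

theory Submission
  imports Defs "HOL-Library.Discrete_Functions"
begin

text \<open>
  Put \<open>Z\<^sub>k = g (X\<^sub>k) - \<mu>\<^sub>k(g)\<close>. These variables are uniformly bounded, and the point is that their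
  correlations decay geometrically in the time difference. Indeed, for \<open>j \<le> k\<close> the Markov
  property over several steps (\<open>markov_chain_cond_exp\<close>) identifies the conditional expectation of
  \<open>Z\<^sub>k\<close> given the past up to time \<open>j\<close> with the difference of the integrals of \<open>g\<close> against
  \<open>P(j, X\<^sub>j, k)\<close> and \<open>\<mu>\<^sub>k\<close>. The total variation bound in the definition of an invariant family makes
  this at most a constant times \<open>\<alpha>\<^bsup>k-j\<^esup> (1 + V(X\<^sub>j))\<close>, and the drift condition together with
  \<open>V(x) < \<infinity>\<close> bounds the expectation of \<open>V(X\<^sub>j)\<close> uniformly in \<open>j\<close> (\<open>markov_chain_drift_moment\<close>).
  Multiplying by the bounded variable \<open>Z\<^sub>j\<close> and integrating gives
  \<open>\<bar>E[Z\<^sub>j Z\<^sub>k]\<bar> \<le> D \<alpha>\<^bsup>k-j\<^esup>\<close> (\<open>centred_observable_correlation_le\<close>).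

  Bounded variables with such correlations obey the strong law
  (\<open>strong_law_decaying_correlations\<close>): the second moment of the sum of the first \<open>n\<close> of them is
  \<open>O(n)\<close>, so the second moments of the averages along \<open>n = m\<^sup>2\<close> are summable in \<open>m\<close> and these
  averages tend to zero almost surely. Between consecutive squares the averages change little,
  because the variables are bounded.
\<close>

section \<open>Averages of bounded sequences with decaying correlations\<close>

lemma averages_tendsto_zero_of_squares:
  fixes z :: "nat \<Rightarrow> real"
  assumes bound: "\<And>k. \<bar>z k\<bar> \<le> b"
    and squares: "(\<lambda>n. (\<Sum>k<n\<^sup>2. z k) / real (n\<^sup>2)) \<longlonglongrightarrow> 0"
  shows "(\<lambda>n. (\<Sum>k<n. z k) / real n) \<longlonglongrightarrow> 0"
proof (rule tendsto_rabs_zero_cancel, rule real_tendsto_sandwich[where f = "\<lambda>_. 0"])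
  define q where "q = floor_sqrt"
  have q_at_top: "filterlim q at_top at_top"
    unfolding filterlim_at_top q_def le_floor_sqrt_iff
    by (auto intro: eventually_ge_at_top)
  have "(\<lambda>m. \<bar>(\<Sum>k<m\<^sup>2. z k) / real (m\<^sup>2)\<bar> + 2 * b * (1 / real m)) \<longlonglongrightarrow> \<bar>0\<bar> + 2 * b * 0"
    by (intro tendsto_intros squares lim_1_over_n)
  then show "(\<lambda>n. \<bar>(\<Sum>k<(q n)\<^sup>2. z k) / real ((q n)\<^sup>2)\<bar> + 2 * b * (1 / real (q n))) \<longlonglongrightarrow> 0"
    using filterlim_compose[OF _ q_at_top] by simp
  have b_nonneg: "0 \<le> b" using bound[of 0] by linarith
  show "\<forall>\<^sub>F n in sequentially. \<bar>(\<Sum>k<n. z k) / real n\<bar>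
      \<le> \<bar>(\<Sum>k<(q n)\<^sup>2. z k) / real ((q n)\<^sup>2)\<bar> + 2 * b * (1 / real (q n))"
    using eventually_gt_at_top[of 0]
  proof eventually_elim
    case (elim n)
    define m where "m = q n"
    \<comment> \<open>Passing from the largest square \<open>m\<^sup>2 \<le> n\<close> to \<open>n\<close> adds at most \<open>2 m\<close> terms, which is
      negligible compared with \<open>m\<^sup>2\<close>.\<close>
    have m_pos: "0 < m" using elim by (simp add: m_def q_def)
    have m_le: "m\<^sup>2 \<le> n" by (simp add: m_def q_def)
    have "n < (Suc m)\<^sup>2" unfolding m_def q_def by (rule Suc_floor_sqrt_power2_gt)
    then have gap: "n - m\<^sup>2 \<le> 2 * m" by (simp add: power2_eq_square)
    have "(\<Sum>k<n. z k) = (\<Sum>k<m\<^sup>2. z k) + (\<Sum>k=m\<^sup>2..<n. z k)"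
      using m_le by (metis atLeast0LessThan sum.atLeastLessThan_concat zero_le)
    moreover have "\<bar>\<Sum>k=m\<^sup>2..<n. z k\<bar> \<le> real (n - m\<^sup>2) * b"
    proof -
      have "\<bar>\<Sum>k=m\<^sup>2..<n. z k\<bar> \<le> (\<Sum>k=m\<^sup>2..<n. \<bar>z k\<bar>)" by (rule sum_abs)
      also have "\<dots> \<le> (\<Sum>k=m\<^sup>2..<n. b)" by (intro sum_mono bound)
      finally show ?thesis by simp
    qed
    moreover have "real (n - m\<^sup>2) * b \<le> 2 * real m * b"
      using gap b_nonneg
      by (metis mult_right_mono of_nat_le_iff of_nat_mult of_nat_numeral)
    ultimately have "\<bar>\<Sum>k<n. z k\<bar> \<le> \<bar>\<Sum>k<m\<^sup>2. z k\<bar> + 2 * real m * b" by linarith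
    then have "\<bar>\<Sum>k<n. z k\<bar> / real n \<le> (\<bar>\<Sum>k<m\<^sup>2. z k\<bar> + 2 * real m * b) / real (m\<^sup>2)"
      using m_le m_pos b_nonneg by (intro frac_le) (auto simp flip: of_nat_power)
    also have "\<dots> = \<bar>\<Sum>k<m\<^sup>2. z k\<bar> / real (m\<^sup>2) + 2 * b * (1 / real m)"
      using m_pos by (simp add: field_simps power2_eq_square)
    finally show ?case by (simp add: m_def)
  qed
qed auto

text \<open>
  The induction adds one variable at a time: the new cross terms \<open>E[Z\<^sub>j Z\<^sub>n]\<close>, \<open>j < n\<close>, are
  dominated by a geometric series, hence bounded independently of \<open>n\<close>.
\<close>

lemma (in prob_space) second_moment_sum_le:
  fixes Z :: "nat \<Rightarrow> 'a \<Rightarrow> real"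
  assumes meas [measurable]: "\<And>k. Z k \<in> borel_measurable M"
    and bound: "\<And>k \<omega>. \<bar>Z k \<omega>\<bar> \<le> b"
    and corr: "\<And>j k. j \<le> k \<Longrightarrow> \<bar>\<integral>\<omega>. Z j \<omega> * Z k \<omega> \<partial>M\<bar> \<le> D * \<alpha> ^ (k - j)"
    and \<alpha>: "0 \<le> \<alpha>" "\<alpha> < 1"
  shows "(\<integral>\<omega>. (\<Sum>k<n. Z k \<omega>)\<^sup>2 \<partial>M) \<le> (D + 2 * D / (1 - \<alpha>)) * real n"
proof (induction n)
  case (Suc n)
  have D: "0 \<le> D" using order_trans[OF abs_ge_zero corr[of 0 0]] by simp
  have b: "0 \<le> b" using bound[of 0 undefined] by linarith
  have int_prod: "integrable M (\<lambda>\<omega>. Z j \<omega> * Z k \<omega>)" for j k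
    by (rule integrable_const_bound[where B = "b * b"])
      (auto simp: abs_mult intro!: mult_mono bound b)
  have int_sq: "integrable M (\<lambda>\<omega>. (\<Sum>k<m. Z k \<omega>)\<^sup>2)" for m
    unfolding power2_eq_square sum_product by (intro Bochner_Integration.integrable_sum int_prod)
  have geometric: "(\<Sum>j<n. \<alpha> ^ (n - j)) \<le> 1 / (1 - \<alpha>)"
  proof -
    have "(\<Sum>j<n. \<alpha> ^ (n - j)) \<le> (\<Sum>j<n. \<alpha> ^ (n - Suc j))"
      using \<alpha> by (intro sum_mono power_decreasing) auto
    also have "\<dots> = (\<Sum>j<n. \<alpha> ^ j)" by (rule sum.nat_diff_reindex)
    also have "\<dots> \<le> 1 / (1 - \<alpha>)"
      using \<alpha> by (simp add: sum_gp_strict divide_right_mono)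
    finally show ?thesis .
  qed
  have "(\<integral>\<omega>. (\<Sum>j<n. Z j \<omega> * Z n \<omega>) \<partial>M) = (\<Sum>j<n. \<integral>\<omega>. Z j \<omega> * Z n \<omega> \<partial>M)"
    by (intro Bochner_Integration.integral_sum int_prod)
  also have "\<dots> \<le> (\<Sum>j<n. D * \<alpha> ^ (n - j))"
    by (intro sum_mono abs_le_D1[OF corr]) auto
  also have "\<dots> \<le> D * (1 / (1 - \<alpha>))"
    unfolding sum_distrib_left[symmetric] by (intro mult_left_mono geometric D)
  finally have cross: "(\<integral>\<omega>. (\<Sum>j<n. Z j \<omega> * Z n \<omega>) \<partial>M) \<le> D / (1 - \<alpha>)" by simp
  have "(\<integral>\<omega>. (\<Sum>k<Suc n. Z k \<omega>)\<^sup>2 \<partial>M)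
      = (\<integral>\<omega>. (\<Sum>k<n. Z k \<omega>)\<^sup>2 + 2 * (\<Sum>j<n. Z j \<omega> * Z n \<omega>) + Z n \<omega> * Z n \<omega> \<partial>M)"
    by (intro Bochner_Integration.integral_cong refl)
      (simp add: power2_eq_square algebra_simps sum_distrib_left)
  also have "\<dots> = (\<integral>\<omega>. (\<Sum>k<n. Z k \<omega>)\<^sup>2 \<partial>M) + 2 * (\<integral>\<omega>. (\<Sum>j<n. Z j \<omega> * Z n \<omega>) \<partial>M)
      + (\<integral>\<omega>. Z n \<omega> * Z n \<omega> \<partial>M)"
    by (simp add: int_sq int_prod)
  also have "\<dots> \<le> (D + 2 * D / (1 - \<alpha>)) * real n + 2 * (D / (1 - \<alpha>)) + D"
    using Suc.IH cross corr[of n n] by simp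
  finally show ?case by (simp add: algebra_simps add_divide_distrib)
qed simp

lemma (in prob_space) strong_law_decaying_correlations:
  fixes Z :: "nat \<Rightarrow> 'a \<Rightarrow> real"
  assumes meas [measurable]: "\<And>k. Z k \<in> borel_measurable M"
    and bound: "\<And>k \<omega>. \<bar>Z k \<omega>\<bar> \<le> b"
    and corr: "\<And>j k. j \<le> k \<Longrightarrow> \<bar>\<integral>\<omega>. Z j \<omega> * Z k \<omega> \<partial>M\<bar> \<le> D * \<alpha> ^ (k - j)"
    and \<alpha>: "0 \<le> \<alpha>" "\<alpha> < 1"
  shows "AE \<omega> in M. (\<lambda>n. (\<Sum>k<n. Z k \<omega>) / real n) \<longlonglongrightarrow> 0"
proof -
  define K where "K = D + 2 * D / (1 - \<alpha>)"
  have b: "0 \<le> b" using bound[of 0 undefined] by linarith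
  have "0 \<le> D" using order_trans[OF abs_ge_zero corr[of 0 0]] by simp
  then have K: "0 \<le> K" using \<alpha> by (simp add: K_def)
  \<comment> \<open>The squared averages along \<open>n\<^sup>2\<close> have summable expectations, so almost surely they are
    themselves summable and tend to zero.\<close>
  define A where "A n \<omega> = ((\<Sum>k<n\<^sup>2. Z k \<omega>) / real (n\<^sup>2))\<^sup>2" for n \<omega>
  have A_meas [measurable]: "A n \<in> borel_measurable M" for n unfolding A_def by measurable
  have A_le: "(\<integral>\<^sup>+\<omega>. ennreal (A n \<omega>) \<partial>M) \<le> ennreal (K * (1 / real (n\<^sup>2)))" for n
  proof (cases "n = 0")
    case False
    have int: "integrable M (\<lambda>\<omega>. (\<Sum>k<n\<^sup>2. Z k \<omega>)\<^sup>2)"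
      unfolding power2_eq_square sum_product
      by (intro Bochner_Integration.integrable_sum integrable_const_bound[where B = "b * b"])
        (auto simp: abs_mult intro!: mult_mono bound b)
    have "(\<integral>\<omega>. A n \<omega> \<partial>M) = (\<integral>\<omega>. (\<Sum>k<n\<^sup>2. Z k \<omega>)\<^sup>2 \<partial>M) / (real (n\<^sup>2))\<^sup>2"
      unfolding A_def power_divide by (rule integral_divide_zero)
    also have "\<dots> \<le> K * real (n\<^sup>2) / (real (n\<^sup>2))\<^sup>2"
      unfolding K_def
      by (intro divide_right_mono second_moment_sum_le[OF meas bound corr \<alpha>]) auto
    also have "\<dots> = K * (1 / real (n\<^sup>2))"
      using False by (simp add: power2_eq_square)
    finally have "(\<integral>\<omega>. A n \<omega> \<partial>M) \<le> K * (1 / real (n\<^sup>2))" .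
    moreover have "(\<integral>\<^sup>+\<omega>. ennreal (A n \<omega>) \<partial>M) = ennreal (\<integral>\<omega>. A n \<omega> \<partial>M)"
      using int by (intro nn_integral_eq_integral) (auto simp: A_def power_divide)
    ultimately show ?thesis by (simp add: ennreal_leI)
  qed (simp add: A_def)
  have sum_inv: "summable (\<lambda>n. K * (1 / real (n\<^sup>2)))"
    using inverse_power_summable[of 2, where 'a = real]
    by (intro summable_mult) (simp add: inverse_eq_divide)
  have "(\<integral>\<^sup>+\<omega>. (\<Sum>n. ennreal (A n \<omega>)) \<partial>M) = (\<Sum>n. \<integral>\<^sup>+\<omega>. ennreal (A n \<omega>) \<partial>M)"
    by (intro nn_integral_suminf) measurable
  also have "\<dots> \<le> (\<Sum>n. ennreal (K * (1 / real (n\<^sup>2))))"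
    by (intro suminf_le A_le summableI)
  also have "\<dots> < \<infinity>"
    unfolding infinity_ennreal_def less_top[symmetric]
    using K by (intro ennreal_suminf_neq_top[OF sum_inv]) simp
  finally have "AE \<omega> in M. (\<Sum>n. ennreal (A n \<omega>)) \<noteq> \<infinity>"
    by (intro nn_integral_noteq_infinite) auto
  then show ?thesis
  proof eventually_elim
    case (elim \<omega>)
    then have "summable (\<lambda>n. A n \<omega>)"
      by (intro summable_suminf_not_top) (auto simp: A_def)
    then have "(\<lambda>n. ((\<Sum>k<n\<^sup>2. Z k \<omega>) / real (n\<^sup>2))\<^sup>2) \<longlonglongrightarrow> 0"
      unfolding A_def by (rule summable_LIMSEQ_zero)
    then have "(\<lambda>n. (\<Sum>k<n\<^sup>2. Z k \<omega>) / real (n\<^sup>2)) \<longlonglongrightarrow> 0"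
      by (rule power_tendsto_0_iff[THEN iffD1, rotated]) simp
    with bound show ?case by (rule averages_tendsto_zero_of_squares)
  qed
qed

section \<open>Several steps of the Markov chain\<close>

lemma transition_kernels_prob:
  assumes "transition_kernels P" "m \<le> n"
  shows "(\<lambda>y. P m y n) \<in> borel \<rightarrow>\<^sub>M prob_algebra borel"
  using assms by (simp add: transition_kernels_def)

lemma transition_kernels_measure:
  assumes "transition_kernels P" "m \<le> n"
  shows "prob_space (P m y n)" "sets (P m y n) = sets borel" "space (P m y n) = UNIV"
proof -
  have "P m y n \<in> space (prob_algebra borel)"
    using measurable_space[OF transition_kernels_prob[OF assms]] by simp
  then show "prob_space (P m y n)" and sets: "sets (P m y n) = sets borel"
    by (auto simp: space_prob_algebra)
  show "space (P m y n) = UNIV" using sets_eq_imp_space_eq[OF sets] by simp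
qed

lemma chapman_kolmogorov_bind:
  assumes P: "transition_kernels P" and le: "l \<le> m" "m \<le> n"
  shows "P l y n = P l y m \<bind> (\<lambda>z. P m z n)"
proof (rule measure_eqI)
  note meas = transition_kernels_prob[OF P le(2), THEN measurable_prob_algebraD]
  have meas': "(\<lambda>z. P m z n) \<in> P l y m \<rightarrow>\<^sub>M subprob_algebra borel"
    using meas transition_kernels_measure(2)[OF P le(1)] by (simp cong: measurable_cong_sets)
  have ne: "space (P l y m) \<noteq> {}" using transition_kernels_measure(3)[OF P le(1)] by simp
  have sets_n: "sets (P l y n) = sets borel"
    using transition_kernels_measure(2)[OF P, of l n] le by simp
  show "sets (P l y n) = sets (P l y m \<bind> (\<lambda>z. P m z n))"
    using sets_bind_measurable[OF meas' ne] sets_n by simp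
  fix A assume "A \<in> sets (P l y n)"
  then have A: "A \<in> sets borel" using sets_n by simp
  have "emeasure (P l y n) A = (\<integral>\<^sup>+ z. emeasure (P m z n) A \<partial>P l y m)"
    using P le A unfolding transition_kernels_def by blast
  also have "\<dots> = emeasure (P l y m \<bind> (\<lambda>z. P m z n)) A"
    by (rule emeasure_bind[OF ne meas' A, symmetric])
  finally show "emeasure (P l y n) A = emeasure (P l y m \<bind> (\<lambda>z. P m z n)) A" .
qed

lemma
  fixes X :: "nat \<Rightarrow> 'a \<Rightarrow> 'b::topological_space"
  assumes "\<And>n. X n \<in> borel_measurable M"
  shows subalgebra_past_algebra: "subalgebra M (past_algebra M X n)"
    and measurable_past_algebra: "j \<le> n \<Longrightarrow> X j \<in> borel_measurable (past_algebra M X n)"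
    and past_algebra_mono: "j \<le> n \<Longrightarrow> sets (past_algebra M X j) \<subseteq> sets (past_algebra M X n)"
proof -
  have sub: "{X j -` A \<inter> space M | j A. j \<le> n \<and> A \<in> sets borel} \<subseteq> Pow (space M)" for n by auto
  have space: "space (past_algebra M X n) = space M" for n
    unfolding past_algebra_def by (rule space_measure_of[OF sub])
  have sets: "sets (past_algebra M X n)
      = sigma_sets (space M) {X j -` A \<inter> space M | j A. j \<le> n \<and> A \<in> sets borel}" for n
    unfolding past_algebra_def by (rule sets_measure_of[OF sub])
  have "{X j -` A \<inter> space M | j A. j \<le> n \<and> A \<in> sets borel} \<subseteq> sets M"
    using assms by (auto intro: measurable_sets)
  then show "subalgebra M (past_algebra M X n)"
    unfolding subalgebra_def space sets by (auto intro!: sets.sigma_sets_subset)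
  show "X j \<in> borel_measurable (past_algebra M X n)" if "j \<le> n"
  proof (rule measurableI)
    fix A :: "'b set" assume "A \<in> sets borel"
    then show "X j -` A \<inter> space (past_algebra M X n) \<in> sets (past_algebra M X n)"
      unfolding space sets using \<open>j \<le> n\<close> by (auto intro!: sigma_sets.Basic)
  qed auto
  show "sets (past_algebra M X j) \<subseteq> sets (past_algebra M X n)" if "j \<le> n"
    unfolding sets using that by (intro sigma_sets_subseteq) (auto intro: order_trans)
qed

text \<open>
  The Markov property with the conditioning replaced by an arbitrary event \<open>F\<close> of the past:
  under the restriction of \<open>M\<close> to \<open>F\<close>, a sub-probability measure, the law of the next state is
  the law of the current state composed with the kernel. In this form the property can be
  iterated using associativity of \<open>\<bind>\<close>.
\<close>

lemma markov_chain_one_step: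
  assumes P: "transition_kernels P" and chain: "markov_chain P M X"
    and F: "F \<in> sets (past_algebra M X n)"
  shows "distr (density M (indicator F)) borel (X (Suc n))
    = distr (density M (indicator F)) borel (X n) \<bind> (\<lambda>y. P (int n) y (int (Suc n)))"
proof (rule measure_eqI)
  interpret prob_space M using chain by (simp add: markov_chain_def)
  have X [measurable]: "X k \<in> borel_measurable M" for k
    using chain by (simp add: markov_chain_def)
  have sub: "subalgebra M (past_algebra M X n)" by (rule subalgebra_past_algebra[OF X])
  interpret S: finite_measure_subalgebra M "past_algebra M X n"
    by standard (rule sub)
  have F' [measurable]: "F \<in> sets M" using F sub by (auto simp: subalgebra_def)
  have ker: "(\<lambda>y. P (int n) y (int (Suc n))) \<in> borel \<rightarrow>\<^sub>M prob_algebra borel"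
    by (rule transition_kernels_prob[OF P]) simp
  have ker': "(\<lambda>y. P (int n) y (int (Suc n)))
      \<in> distr (density M (indicator F)) borel (X n) \<rightarrow>\<^sub>M subprob_algebra borel"
    using measurable_prob_algebraD[OF ker] by (simp cong: measurable_cong_sets)
  show "sets (distr (density M (indicator F)) borel (X (Suc n)))
    = sets (distr (density M (indicator F)) borel (X n) \<bind> (\<lambda>y. P (int n) y (int (Suc n))))"
    by (subst sets_bind_measurable[OF ker']) auto
  fix A assume "A \<in> sets (distr (density M (indicator F)) borel (X (Suc n)))"
  then have A [measurable]: "A \<in> sets borel" by simp
  define p where "p y = measure (P (int n) y (int (Suc n))) A" for y
  have p [measurable]: "p \<in> borel_measurable borel"
    unfolding p_def
    using measurable_compose[OF ker measurable_measure_prob_algebra[OF A]] by (simp add: comp_def)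
  have p_bounds: "0 \<le> p y" "p y \<le> 1" for y
    using transition_kernels_measure(1)[OF P, of "int n" "int (Suc n)" y]
    by (auto simp: p_def prob_space.prob_le_1)
  have p_em: "emeasure (P (int n) y (int (Suc n))) A = ennreal (p y)" for y
  proof -
    interpret K: prob_space "P (int n) y (int (Suc n))"
      using transition_kernels_measure(1)[OF P] by simp
    show ?thesis by (simp only: p_def K.emeasure_eq_measure)
  qed
  have "(\<integral>\<omega>. indicat_real F \<omega> * indicat_real A (X (Suc n) \<omega>) \<partial>M)
      = (\<integral>\<omega>. indicat_real F \<omega> * real_cond_exp M (past_algebra M X n)
            (\<lambda>\<omega>'. indicat_real A (X (Suc n) \<omega>')) \<omega> \<partial>M)"
    using F by (intro S.real_cond_exp_intg(2)[symmetric] integrable_const_bound[where B = 1])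
      (auto simp: indicator_def)
  also have "\<dots> = (\<integral>\<omega>. indicat_real F \<omega> * p (X n \<omega>) \<partial>M)"
  proof (rule integral_cong_AE)
    have "AE \<omega> in M. real_cond_exp M (past_algebra M X n)
        (\<lambda>\<omega>'. indicat_real A (X (Suc n) \<omega>')) \<omega> = p (X n \<omega>)"
      using chain A by (simp add: markov_chain_def p_def)
    then show "AE \<omega> in M. indicat_real F \<omega> * real_cond_exp M (past_algebra M X n)
        (\<lambda>\<omega>'. indicat_real A (X (Suc n) \<omega>')) \<omega> = indicat_real F \<omega> * p (X n \<omega>)"
      by eventually_elim simp
  qed auto
  finally have eq: "(\<integral>\<omega>. indicat_real F \<omega> * indicat_real A (X (Suc n) \<omega>) \<partial>M)
      = (\<integral>\<omega>. indicat_real F \<omega> * p (X n \<omega>) \<partial>M)" .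
  have "emeasure (distr (density M (indicator F)) borel (X (Suc n))) A
      = (\<integral>\<^sup>+\<omega>. indicator A (X (Suc n) \<omega>) \<partial>density M (indicator F))"
    by (simp flip: nn_integral_indicator add: nn_integral_distr)
  also have "\<dots> = (\<integral>\<^sup>+\<omega>. ennreal (indicat_real F \<omega> * indicat_real A (X (Suc n) \<omega>)) \<partial>M)"
    by (subst nn_integral_density) (auto intro!: nn_integral_cong simp: indicator_def)
  also have "\<dots> = ennreal (\<integral>\<omega>. indicat_real F \<omega> * indicat_real A (X (Suc n) \<omega>) \<partial>M)"
    by (intro nn_integral_eq_integral integrable_const_bound[where B = 1])
      (auto simp: indicator_def)
  also have "\<dots> = ennreal (\<integral>\<omega>. indicat_real F \<omega> * p (X n \<omega>) \<partial>M)" by (simp only: eq)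
  also have "\<dots> = (\<integral>\<^sup>+\<omega>. ennreal (indicat_real F \<omega> * p (X n \<omega>)) \<partial>M)"
    using p_bounds by (intro nn_integral_eq_integral[symmetric] integrable_const_bound[where B = 1])
      (auto simp: indicator_def)
  also have "\<dots> = (\<integral>\<^sup>+\<omega>. ennreal (p (X n \<omega>)) \<partial>density M (indicator F))"
    by (subst nn_integral_density) (auto intro!: nn_integral_cong simp: indicator_def)
  also have "\<dots> = (\<integral>\<^sup>+y. ennreal (p y) \<partial>distr (density M (indicator F)) borel (X n))"
    by (subst nn_integral_distr) auto
  also have "\<dots> = emeasure (distr (density M (indicator F)) borel (X n)
      \<bind> (\<lambda>y. P (int n) y (int (Suc n)))) A"
    unfolding p_em[symmetric] by (rule emeasure_bind[OF _ ker' A, symmetric]) simp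
  finally show "emeasure (distr (density M (indicator F)) borel (X (Suc n))) A
    = emeasure (distr (density M (indicator F)) borel (X n)
        \<bind> (\<lambda>y. P (int n) y (int (Suc n)))) A" .
qed

lemma markov_chain_steps:
  assumes P: "transition_kernels P" and chain: "markov_chain P M X"
    and F: "F \<in> sets (past_algebra M X j)" and "j \<le> k"
  shows "distr (density M (indicator F)) borel (X k)
    = distr (density M (indicator F)) borel (X j) \<bind> (\<lambda>y. P (int j) y (int k))"
  using \<open>j \<le> k\<close>
proof (induction k rule: dec_induct)
  case base
  have "(\<lambda>y. P (int j) y (int j)) = return borel"
    using P unfolding transition_kernels_def by blast
  then show ?case by (simp add: bind_return'')
next
  case (step k)
  let ?D = "\<lambda>i. distr (density M (indicator F)) borel (X i)"
  have X: "X i \<in> borel_measurable M" for i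
    using chain by (simp add: markov_chain_def)
  have ker: "(\<lambda>y. P (int j) y (int k)) \<in> ?D j \<rightarrow>\<^sub>M subprob_algebra borel"
    "(\<lambda>y. P (int k) y (int (Suc k))) \<in> borel \<rightarrow>\<^sub>M subprob_algebra borel"
    using step.hyps transition_kernels_prob[OF P, THEN measurable_prob_algebraD]
    by (simp_all cong: measurable_cong_sets)
  have "F \<in> sets (past_algebra M X k)"
    using F past_algebra_mono[where X = X, OF X step.hyps(1)] by auto
  then have "?D (Suc k) = ?D k \<bind> (\<lambda>y. P (int k) y (int (Suc k)))"
    by (rule markov_chain_one_step[OF P chain])
  also have "\<dots> = ?D j \<bind> (\<lambda>y. P (int j) y (int k) \<bind> (\<lambda>z. P (int k) z (int (Suc k))))"
    unfolding step.IH by (rule bind_assoc[OF ker])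
  also have "\<dots> = ?D j \<bind> (\<lambda>y. P (int j) y (int (Suc k)))"
    using step.hyps by (subst chapman_kolmogorov_bind[OF P, of "int j" "int k" "int (Suc k)"]) auto
  finally show ?case .
qed

lemma markov_chain_cond_exp:
  fixes g :: "'a::polish_space \<Rightarrow> real"
  assumes P: "transition_kernels P" and chain: "markov_chain P M X"
    and g [measurable]: "g \<in> borel_measurable borel" and bound: "\<And>y. \<bar>g y\<bar> \<le> b" and "j \<le> k"
  shows "AE \<omega> in M. real_cond_exp M (past_algebra M X j) (\<lambda>\<omega>. g (X k \<omega>)) \<omega>
    = (\<integral>y. g y \<partial>P (int j) (X j \<omega>) (int k))"
proof -
  interpret prob_space M using chain by (simp add: markov_chain_def)
  have X [measurable]: "X k \<in> borel_measurable M" for k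
    using chain by (simp add: markov_chain_def)
  have sub: "subalgebra M (past_algebra M X j)" by (rule subalgebra_past_algebra[OF X])
  interpret S: finite_measure_subalgebra M "past_algebra M X j"
    by standard (rule sub)
  note Xpast [measurable] = measurable_past_algebra[where X = X, OF X order_refl[of j]]
  define h where "h y = (\<integral>z. g z \<partial>P (int j) y (int k))" for y
  have ker: "(\<lambda>y. P (int j) y (int k)) \<in> borel \<rightarrow>\<^sub>M subprob_algebra borel"
    using \<open>j \<le> k\<close> transition_kernels_prob[OF P, THEN measurable_prob_algebraD] by simp
  have h [measurable]: "h \<in> borel_measurable borel"
    unfolding h_def using measurable_compose[OF ker integral_measurable_subprob_algebra[OF g]] .
  have Pprob: "prob_space (P (int j) y (int k))" for y
    using transition_kernels_measure(1)[OF P] \<open>j \<le> k\<close> by simp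
  have h_bound: "\<bar>h y\<bar> \<le> b" for y
  proof -
    interpret K: prob_space "P (int j) y (int k)" by (rule Pprob)
    have "integrable (P (int j) y (int k)) g"
      using transition_kernels_measure(2)[OF P, of "int j" "int k" y] \<open>j \<le> k\<close> bound
      by (intro K.integrable_const_bound[where B = b]) (auto cong: measurable_cong_sets)
    then have "\<bar>h y\<bar> \<le> (\<integral>z. \<bar>g z\<bar> \<partial>P (int j) y (int k))"
      unfolding h_def by (intro integral_abs_bound)
    also have "\<dots> \<le> (\<integral>z. b \<partial>P (int j) y (int k))"
      using \<open>integrable _ g\<close> bound by (intro integral_mono) auto
    finally show ?thesis by (simp add: K.prob_space)
  qed
  have "AE \<omega> in M. real_cond_exp M (past_algebra M X j) (\<lambda>\<omega>. g (X k \<omega>)) \<omega> = h (X j \<omega>)"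
  proof (rule S.real_cond_exp_charact)
    fix F assume F: "F \<in> sets (past_algebra M X j)"
    then have [measurable]: "F \<in> sets M" using sub by (auto simp: subalgebra_def)
    let ?D = "\<lambda>i. distr (density M (indicator F)) borel (X i)"
    have set_int: "(\<integral>\<omega>\<in>F. f (X i \<omega>) \<partial>M) = (\<integral>y. f y \<partial>?D i)"
      if [measurable]: "f \<in> borel_measurable borel" for f :: "'a \<Rightarrow> real" and i
    proof -
      have "(\<integral>y. f y \<partial>?D i) = (\<integral>\<omega>. f (X i \<omega>) \<partial>density M (\<lambda>\<omega>. ennreal (indicat_real F \<omega>)))"
        by (subst integral_distr) (auto simp: ennreal_indicator)
      also have "\<dots> = (\<integral>\<omega>\<in>F. f (X i \<omega>) \<partial>M)"
        by (subst integral_density) (auto simp: set_lebesgue_integral_def)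
      finally show ?thesis by simp
    qed
    have fin: "finite_measure (?D j)"
    proof (rule finite_measureI)
      have "emeasure (?D j) (space (?D j))
          = (\<integral>\<^sup>+\<omega>. indicator F \<omega> * indicator (space M) \<omega> \<partial>M)"
        by (simp add: emeasure_distr emeasure_density)
      also have "\<dots> \<le> (\<integral>\<^sup>+\<omega>. 1 \<partial>M)"
        by (intro nn_integral_mono) (simp add: indicator_def)
      finally show "emeasure (?D j) (space (?D j)) \<noteq> \<infinity>"
        by (auto simp: emeasure_space_1 top_unique)
    qed
    have "(\<integral>y. g y \<partial>?D k) = (\<integral>y. g y \<partial>(?D j \<bind> (\<lambda>y. P (int j) y (int k))))"
      by (simp only: markov_chain_steps[OF P chain F \<open>j \<le> k\<close>])
    also have "\<dots> = (\<integral>y. h y \<partial>?D j)"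
      unfolding h_def
    proof (rule integral_bind[where K = borel and B = b and B' = 1])
      show "AE y in ?D j. emeasure (P (int j) y (int k)) (space (P (int j) y (int k))) \<le> ennreal 1"
        using Pprob by (simp add: prob_space.emeasure_space_1)
    qed (use ker bound fin in \<open>auto cong: measurable_cong_sets\<close>)
    finally show "(\<integral>\<omega>\<in>F. g (X k \<omega>) \<partial>M) = (\<integral>\<omega>\<in>F. h (X j \<omega>) \<partial>M)"
      by (simp add: set_int)
  next
    show "integrable M (\<lambda>\<omega>. g (X k \<omega>))" "integrable M (\<lambda>\<omega>. h (X j \<omega>))"
      using bound h_bound by (auto intro!: integrable_const_bound[where B = b])
  qed measurable
  then show ?thesis by (simp add: h_def)
qed

section \<open>Consequences of the drift condition and of the ergodicity bound\<close>

text \<open>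
  One step of the chain turns a bound \<open>t\<close> for the moment of \<open>V\<close> into \<open>\<gamma> t + C\<close>, an affine map
  with fixed point \<open>C / (1 - \<gamma>)\<close>.
\<close>

lemma markov_chain_drift_moment:
  assumes P: "transition_kernels P" and chain: "markov_chain P M X"
    and V [measurable]: "V \<in> borel_measurable borel"
    and drift: "\<And>y n. (\<integral>\<^sup>+ z. V z \<partial>P (n - 1) y n) \<le> ennreal \<gamma> * V y + ennreal C"
    and \<gamma>: "0 < \<gamma>" "\<gamma> < 1" and C: "0 < C"
    and init: "distr M borel (X 0) = return borel x"
  shows "(\<integral>\<^sup>+\<omega>. V (X n \<omega>) \<partial>M) \<le> V x + ennreal (C / (1 - \<gamma>))"
proof (induction n)
  case 0
  have X: "X 0 \<in> borel_measurable M"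
    using chain by (simp add: markov_chain_def)
  have "(\<integral>\<^sup>+\<omega>. V (X 0 \<omega>) \<partial>M) = (\<integral>\<^sup>+y. V y \<partial>distr M borel (X 0))"
    using X by (subst nn_integral_distr) auto
  also have "\<dots> = V x" by (simp add: init nn_integral_return)
  finally show ?case by simp
next
  case (Suc n)
  have X [measurable]: "X k \<in> borel_measurable M" for k
    using chain by (simp add: markov_chain_def)
  interpret prob_space M using chain by (simp add: markov_chain_def)
  \<comment> \<open>The one-step identity of laws, with the whole space as the event of the past.\<close>
  have whole: "density M (indicator (space (past_algebra M X n))) = M"
  proof -
    have "space (past_algebra M X n) = space M"
      using subalgebra_past_algebra[where M = M and X = X] X by (auto simp: subalgebra_def)
    then have "density M (indicator (space (past_algebra M X n))) = density M (\<lambda>_. 1)"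
      by (intro density_cong) auto
    then show ?thesis by (simp add: density_1)
  qed
  have ker: "(\<lambda>y. P (int n) y (int (Suc n))) \<in> distr M borel (X n) \<rightarrow>\<^sub>M subprob_algebra borel"
    using transition_kernels_prob[OF P, THEN measurable_prob_algebraD]
    by (simp cong: measurable_cong_sets)
  have law: "distr M borel (X (Suc n))
      = distr M borel (X n) \<bind> (\<lambda>y. P (int n) y (int (Suc n)))"
    using markov_chain_one_step[OF P chain sets.top[of "past_algebra M X n"]] by (simp only: whole)
  have "(\<integral>\<^sup>+\<omega>. V (X (Suc n) \<omega>) \<partial>M) = (\<integral>\<^sup>+y. V y \<partial>distr M borel (X (Suc n)))"
    by (subst nn_integral_distr) auto
  also have "\<dots> = (\<integral>\<^sup>+y. \<integral>\<^sup>+z. V z \<partial>P (int n) y (int (Suc n)) \<partial>distr M borel (X n))"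
    unfolding law by (rule nn_integral_bind[OF V ker])
  also have "\<dots> \<le> (\<integral>\<^sup>+y. ennreal \<gamma> * V y + ennreal C \<partial>distr M borel (X n))"
    using drift[of "int (Suc n)"] by (intro nn_integral_mono) simp
  also have "\<dots> = ennreal \<gamma> * (\<integral>\<^sup>+\<omega>. V (X n \<omega>) \<partial>M) + ennreal C"
    by (subst nn_integral_distr) (auto simp: nn_integral_add nn_integral_cmult emeasure_space_1)
  also have "\<dots> \<le> ennreal \<gamma> * (V x + ennreal (C / (1 - \<gamma>))) + ennreal C"
    by (intro add_right_mono mult_left_mono Suc.IH) auto
  also have "\<dots> = ennreal \<gamma> * V x + ennreal (\<gamma> * (C / (1 - \<gamma>)) + C)"
    using \<gamma> C by (simp add: distrib_left ennreal_mult add.assoc del: times_divide_eq_right)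
  also have "\<gamma> * (C / (1 - \<gamma>)) + C = C / (1 - \<gamma>)"
    using \<gamma> by (simp add: field_simps)
  also have "ennreal \<gamma> * V x + ennreal (C / (1 - \<gamma>)) \<le> 1 * V x + ennreal (C / (1 - \<gamma>))"
    using \<gamma> by (intro add_right_mono mult_right_mono) auto
  finally show ?case by simp
qed

lemma tv_norm_diff_integral_le:
  fixes g :: "'a::topological_space \<Rightarrow> real"
  assumes g: "g \<in> borel_measurable borel" and bound: "\<And>y. \<bar>g y\<bar> \<le> b" and b: "0 < b"
  shows "ennreal \<bar>(\<integral>y. g y \<partial>M) - (\<integral>y. g y \<partial>N)\<bar> \<le> ennreal b * tv_norm_diff M N"
proof -
  define \<phi> where "\<phi> y = g y / b" for y
  have "ennreal \<bar>(\<integral>y. \<phi> y \<partial>M) - (\<integral>y. \<phi> y \<partial>N)\<bar> \<le> tv_norm_diff M N"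
    unfolding tv_norm_diff_def using g bound b by (intro SUP_upper) (auto simp: \<phi>_def)
  then have "ennreal b * ennreal \<bar>(\<integral>y. \<phi> y \<partial>M) - (\<integral>y. \<phi> y \<partial>N)\<bar> \<le> ennreal b * tv_norm_diff M N"
    by (rule mult_left_mono) simp
  moreover have "(\<integral>y. \<phi> y \<partial>L) = (\<integral>y. g y \<partial>L) / b" for L
    unfolding \<phi>_def by (rule integral_divide_zero)
  ultimately show ?thesis
    using b by (simp flip: ennreal_mult diff_divide_distrib)
qed

text \<open>
  The decay of correlations in its basic form. Here \<open>c\<close> measures how well the kernel from time \<open>j\<close>
  to time \<open>k\<close> approximates \<open>\<nu>\<close>; any bounded variable \<open>W\<close> determined by the past up to time \<open>j\<close> is
  then nearly orthogonal to the deviation of \<open>g (X\<^sub>k)\<close> from the \<open>\<nu>\<close>-mean of \<open>g\<close>.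
\<close>

lemma centred_observable_correlation_le:
  fixes g :: "'a::polish_space \<Rightarrow> real"
  assumes P: "transition_kernels P" and chain: "markov_chain P M X"
    and g [measurable]: "g \<in> borel_measurable borel" and bound: "\<And>y. \<bar>g y\<bar> \<le> b" and b: "0 < b"
    and V [measurable]: "V \<in> borel_measurable borel"
    and moment: "(\<integral>\<^sup>+\<omega>. V (X j \<omega>) \<partial>M) \<le> ennreal K" and K: "0 \<le> K"
    and "j \<le> k"
    and tv: "\<And>y. tv_norm_diff (P (int j) y (int k)) \<nu> \<le> ennreal c * (1 + V y)" and c: "0 \<le> c"
    and W: "W \<in> borel_measurable (past_algebra M X j)" and W_bound: "\<And>\<omega>. \<bar>W \<omega>\<bar> \<le> w"
  shows "\<bar>\<integral>\<omega>. W \<omega> * (g (X k \<omega>) - (\<integral>y. g y \<partial>\<nu>)) \<partial>M\<bar> \<le> w * b * c * (1 + K)"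
proof -
  interpret prob_space M using chain by (simp add: markov_chain_def)
  have X [measurable]: "X k \<in> borel_measurable M" for k
    using chain by (simp add: markov_chain_def)
  have sub: "subalgebra M (past_algebra M X j)" by (rule subalgebra_past_algebra[OF X])
  interpret S: finite_measure_subalgebra M "past_algebra M X j"
    by standard (rule sub)
  have [measurable]: "W \<in> borel_measurable M" by (rule measurable_from_subalg[OF sub W])
  have w: "0 \<le> w" using W_bound[of undefined] by linarith
  define m where "m = (\<integral>y. g y \<partial>\<nu>)"
  define h where "h y = (\<integral>z. g z \<partial>P (int j) y (int k))" for y
  have ker: "(\<lambda>y. P (int j) y (int k)) \<in> borel \<rightarrow>\<^sub>M subprob_algebra borel"
    using \<open>j \<le> k\<close> transition_kernels_prob[OF P, THEN measurable_prob_algebraD] by simp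
  have h [measurable]: "h \<in> borel_measurable borel"
    unfolding h_def using measurable_compose[OF ker integral_measurable_subprob_algebra[OF g]] .
  have int_Wg: "integrable M (\<lambda>\<omega>. W \<omega> * g (X k \<omega>))"
    using W_bound bound w
    by (intro integrable_const_bound[where B = "w * b"]) (auto simp: abs_mult intro!: mult_mono)
  have int_W: "integrable M W"
    using W_bound by (intro integrable_const_bound[where B = w]) auto
  have cond: "AE \<omega> in M. W \<omega> * real_cond_exp M (past_algebra M X j) (\<lambda>\<omega>. g (X k \<omega>)) \<omega>
      = W \<omega> * h (X j \<omega>)"
    using markov_chain_cond_exp[OF P chain g bound \<open>j \<le> k\<close>] by (auto simp: h_def)
  have int_Wc: "integrable M (\<lambda>\<omega>. W \<omega> * real_cond_exp M (past_algebra M X j) (\<lambda>\<omega>. g (X k \<omega>)) \<omega>)"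
    by (rule S.real_cond_exp_intg(1)[OF int_Wg W]) measurable
  have int_Wh: "integrable M (\<lambda>\<omega>. W \<omega> * h (X j \<omega>))"
    by (rule integrable_cong_AE_imp[OF int_Wc _ cond]) measurable
  have "(\<integral>\<omega>. W \<omega> * g (X k \<omega>) \<partial>M)
      = (\<integral>\<omega>. W \<omega> * real_cond_exp M (past_algebra M X j) (\<lambda>\<omega>. g (X k \<omega>)) \<omega> \<partial>M)"
    by (rule S.real_cond_exp_intg(2)[symmetric, OF int_Wg W]) measurable
  also have "\<dots> = (\<integral>\<omega>. W \<omega> * h (X j \<omega>) \<partial>M)"
    by (rule integral_cong_AE[OF _ _ cond]) measurable
  finally have "(\<integral>\<omega>. W \<omega> * (g (X k \<omega>) - m) \<partial>M) = (\<integral>\<omega>. W \<omega> * (h (X j \<omega>) - m) \<partial>M)"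
    using int_Wg int_Wh int_W by (simp add: right_diff_distrib)
  \<comment> \<open>From here on in \<open>ennreal\<close>, since \<open>V\<close> may take the value \<open>\<infinity>\<close> on a null set.\<close>
  also have "ennreal \<bar>\<dots>\<bar> \<le> (\<integral>\<^sup>+\<omega>. ennreal \<bar>W \<omega> * (h (X j \<omega>) - m)\<bar> \<partial>M)"
    using integral_norm_bound_ennreal[of M "\<lambda>\<omega>. W \<omega> * (h (X j \<omega>) - m)"] int_Wh int_W
    by (simp add: right_diff_distrib)
  also have "\<dots> \<le> (\<integral>\<^sup>+\<omega>. ennreal (w * b * c) * (1 + V (X j \<omega>)) \<partial>M)"
  proof (rule nn_integral_mono)
    fix \<omega>
    have "ennreal \<bar>h (X j \<omega>) - m\<bar> \<le> ennreal b * (ennreal c * (1 + V (X j \<omega>)))"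
      unfolding h_def m_def
      using tv_norm_diff_integral_le[OF g bound b] tv
      by (rule order_trans[OF _ mult_left_mono]) simp
    moreover have "ennreal \<bar>W \<omega>\<bar> \<le> ennreal w" by (intro ennreal_leI W_bound)
    ultimately have "ennreal \<bar>W \<omega>\<bar> * ennreal \<bar>h (X j \<omega>) - m\<bar>
        \<le> ennreal w * (ennreal b * (ennreal c * (1 + V (X j \<omega>))))"
      by (intro mult_mono) auto
    then show "ennreal \<bar>W \<omega> * (h (X j \<omega>) - m)\<bar> \<le> ennreal (w * b * c) * (1 + V (X j \<omega>))"
      using w b c by (simp add: abs_mult ennreal_mult mult.assoc)
  qed
  also have "\<dots> = ennreal (w * b * c) * (1 + (\<integral>\<^sup>+\<omega>. V (X j \<omega>) \<partial>M))"
    by (simp add: nn_integral_cmult nn_integral_add emeasure_space_1)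
  also have "\<dots> \<le> ennreal (w * b * c) * (1 + ennreal K)"
    by (intro mult_left_mono add_left_mono moment) auto
  also have "\<dots> = ennreal (w * b * c * (1 + K))"
    using w b c K by (simp add: ennreal_mult)
  finally show ?thesis
    using w b c K by (simp add: m_def)
qed

section \<open>The strong law for the chain\<close>

theorem theorem3p3:
  fixes P :: "int \<Rightarrow> 'a::polish_space \<Rightarrow> int \<Rightarrow> 'a measure"
    and V :: "'a \<Rightarrow> ennreal"
    and \<mu> :: "int \<Rightarrow> 'a measure"
    and x :: 'a
    and g :: "'a \<Rightarrow> real"
    and M :: "'w measure"
    and X :: "nat \<Rightarrow> 'w \<Rightarrow> 'a"
  assumes "transition_kernels P"
    and "drift_condition P V"
    and "doeblin_condition P V"
    and "invariant_family P V \<mu>"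
    and "V x < \<infinity>"
    and "g \<in> borel_measurable borel"
    and "bounded (range g)"
    and "markov_chain P M X"
    and "distr M borel (X 0) = return borel x"
  shows "AE \<omega> in M.
    (\<lambda>n::nat. 1 / real n * (\<Sum>k<n. g (X k \<omega>)) - 1 / real n * (\<Sum>k<n. \<integral>y. g y \<partial>\<mu> (int k)))
      \<longlonglongrightarrow> 0"
proof -
  note P = assms(1) and g = assms(6) and chain = assms(8)
  interpret prob_space M using chain by (simp add: markov_chain_def)
  have X: "X k \<in> borel_measurable M" for k
    using chain by (simp add: markov_chain_def)
  obtain b where b: "0 < b" "\<And>y. \<bar>g y\<bar> \<le> b"
    using assms(7) by (auto simp: bounded_pos)
  obtain \<gamma> C where V: "V \<in> borel_measurable borel" and \<gamma>: "0 < \<gamma>" "\<gamma> < 1" and C: "0 < C"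
    and drift: "\<And>y n. (\<integral>\<^sup>+ z. V z \<partial>P (n - 1) y n) \<le> ennreal \<gamma> * V y + ennreal C"
    using assms(2) by (auto simp: drift_condition_def)
  obtain \<alpha> L where \<mu>: "\<And>n. \<mu> n \<in> space (prob_algebra borel)"
    and \<alpha>: "0 < \<alpha>" "\<alpha> < 1" and L: "0 < L"
    and tv: "\<And>n y m. tv_norm_diff (P (n - int m) y n) (\<mu> n) \<le> ennreal (L * \<alpha> ^ m) * (1 + V y)"
    using assms(4) by (auto simp: invariant_family_def)
  obtain v where v: "0 \<le> v" "V x = ennreal v" using assms(5) by (cases "V x") auto
  define K where "K = v + C / (1 - \<gamma>)"
  have K: "0 \<le> K" using v \<gamma> C by (simp add: K_def)
  have moment: "(\<integral>\<^sup>+\<omega>. V (X j \<omega>) \<partial>M) \<le> ennreal K" for j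
    using markov_chain_drift_moment[OF P chain V drift \<gamma> C assms(9), of j] v \<gamma> C
    by (simp add: K_def)
  define Z where "Z k \<omega> = g (X k \<omega>) - (\<integral>y. g y \<partial>\<mu> (int k))" for k \<omega>
  have mean_bound: "\<bar>\<integral>y. g y \<partial>\<mu> n\<bar> \<le> b" for n
  proof -
    interpret N: prob_space "\<mu> n" using \<mu> by (simp add: space_prob_algebra)
    have int: "integrable (\<mu> n) g"
      using \<mu>[of n] g b by (intro N.integrable_const_bound[where B = b])
        (auto simp: space_prob_algebra cong: measurable_cong_sets)
    then have "\<bar>\<integral>y. g y \<partial>\<mu> n\<bar> \<le> (\<integral>y. \<bar>g y\<bar> \<partial>\<mu> n)" by (intro integral_abs_bound)
    also have "\<dots> \<le> (\<integral>y. b \<partial>\<mu> n)" using int b by (intro integral_mono) auto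
    finally show ?thesis by (simp add: N.prob_space)
  qed
  have Z_bound: "\<bar>Z k \<omega>\<bar> \<le> 2 * b" for k \<omega>
    using b(2)[of "X k \<omega>"] mean_bound[of "int k"] by (simp add: Z_def)
  have "AE \<omega> in M. (\<lambda>n. (\<Sum>k<n. Z k \<omega>) / real n) \<longlonglongrightarrow> 0"
  proof (rule strong_law_decaying_correlations)
    show "Z k \<in> borel_measurable M" for k
      unfolding Z_def using X g by measurable
    show "\<bar>Z k \<omega>\<bar> \<le> 2 * b" for k \<omega> by (rule Z_bound)
    show "0 \<le> \<alpha>" "\<alpha> < 1" using \<alpha> by auto
    fix j k :: nat assume "j \<le> k"
    have "tv_norm_diff (P (int j) y (int k)) (\<mu> (int k)) \<le> ennreal (L * \<alpha> ^ (k - j)) * (1 + V y)" for y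
      using tv[of "int k" "k - j" y] \<open>j \<le> k\<close> by (simp add: of_nat_diff)
    moreover have "Z j \<in> borel_measurable (past_algebra M X j)"
      unfolding Z_def using measurable_past_algebra[where X = X, OF X order_refl[of j]] g by measurable
    ultimately have "\<bar>\<integral>\<omega>. Z j \<omega> * (g (X k \<omega>) - (\<integral>y. g y \<partial>\<mu> (int k))) \<partial>M\<bar>
        \<le> 2 * b * b * (L * \<alpha> ^ (k - j)) * (1 + K)"
      using \<alpha> L \<open>j \<le> k\<close>
      by (intro centred_observable_correlation_le[OF P chain g b(2,1) V moment K])
        (auto intro: Z_bound)
    then show "\<bar>\<integral>\<omega>. Z j \<omega> * Z k \<omega> \<partial>M\<bar> \<le> (2 * b * b * L * (1 + K)) * \<alpha> ^ (k - j)"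
      by (simp add: Z_def algebra_simps)
  qed
  then show ?thesis
    by (simp add: Z_def sum_subtractf diff_divide_distrib)
qed

end
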